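(* Let $\delta\in[0,1/10)$ and let $M,N\colon G\to\mathbb C$. Assume that $\Psi_{M,M}\neq0$ and $$|\Psi_M\Psi_{M,N}|\ge(1-\delta)\,|\Psi_N|\,\Psi_{M,M}.$$ Then $$\beta(N)\le(1+4\delta)\,\beta(M).$$
   Context: $G$ is an (indexing) set, $L\colon G\to\mathbb C$ is a function, and $w\colon G\to[0,\infty)$ is a weight function, not identically $0$. For $f\colon G\to\mathbb C$ put $\mathbb E^w_{\pi\in G}f(\pi):=\frac{\sum_{\pi\in G}w(\pi)f(\pi)}{\sum_{\pi\in G}w(\pi)}$. For $M,N\colon G\to\mathbb C$ define $\Psi_M:=\mathbb E^w_{\pi\in G}L(\pi)M(\pi)$, $\Psi_{M,N}:=\mathbb E^w_{\pi\in G}L(\pi)M(\pi)\overline{L(\pi)N(\pi)}$, and $\beta(M):=|\Psi_M|^2/\Psi_{M,M}$ if $\Psi_{M,M}\ne0$, $\beta(M):=0$ if $\Psi_{M,M}=0$. It is assumed that the series $\sum_\pi w(\pi)$ and $\sum_\pi w(\pi)|L(\pi)M(\pi)|^2$ converge for every function $M$ considered (automatic if $G$ is finite). *)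

theory Defs
  imports "HOL-Analysis.Analysis"
begin

text \<open>Sums over the possibly infinite index set \<open>G\<close> are unordered; for complex-valued
  families this is the same as absolute convergence.\<close>

definition wexp :: "'a set \<Rightarrow> ('a \<Rightarrow> real) \<Rightarrow> ('a \<Rightarrow> complex) \<Rightarrow> complex" where
  "wexp G w f =
     (\<Sum>\<^sub>\<infinity>\<pi>\<in>G. complex_of_real (w \<pi>) * f \<pi>) / complex_of_real (\<Sum>\<^sub>\<infinity>\<pi>\<in>G. w \<pi>)"

definition Psi :: "'a set \<Rightarrow> ('a \<Rightarrow> real) \<Rightarrow> ('a \<Rightarrow> complex) \<Rightarrow> ('a \<Rightarrow> complex) \<Rightarrow> complex" where
  "Psi G w L M = wexp G w (\<lambda>\<pi>. L \<pi> * M \<pi>)"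

definition Psi2 :: "'a set \<Rightarrow> ('a \<Rightarrow> real) \<Rightarrow> ('a \<Rightarrow> complex) \<Rightarrow> ('a \<Rightarrow> complex) \<Rightarrow> ('a \<Rightarrow> complex) \<Rightarrow> complex" where
  "Psi2 G w L M N = wexp G w (\<lambda>\<pi>. L \<pi> * M \<pi> * cnj (L \<pi> * N \<pi>))"

text \<open>The diagonal value \<open>Psi2 G w L M M\<close> is a real number, so that taking its real part below
  is only a change of type.\<close>

lemma Psi2_diag_real:
  "complex_of_real (Re (Psi2 G w L M M)) = Psi2 G w L M M"
proof -
  have "cnj (Psi2 G w L M M) = Psi2 G w L M M"
    unfolding Psi2_def wexp_def complex_cnj_divide infsum_cnj [symmetric]
    by (simp add: mult_ac)
  then show ?thesis
    by (simp add: complex_eq_iff)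
qed

definition beta :: "'a set \<Rightarrow> ('a \<Rightarrow> real) \<Rightarrow> ('a \<Rightarrow> complex) \<Rightarrow> ('a \<Rightarrow> complex) \<Rightarrow> real" where
  "beta G w L M =
     (if Psi2 G w L M M \<noteq> 0 then (cmod (Psi G w L M))\<^sup>2 / Re (Psi2 G w L M M) else 0)"

end

theory Submission
  imports Defs
begin

text \<open>By Cauchy--Schwarz, \<open>|\<Psi>\<^bsub>M,N\<^esub>|\<^sup>2 \<le> \<Psi>\<^bsub>M,M\<^esub> \<Psi>\<^bsub>N,N\<^esub>\<close>; squaring the hypothesis and
  inserting this gives \<open>(1 - \<delta>)\<^sup>2 \<beta>(N) \<le> \<beta>(M)\<close>. It remains to note that
  \<open>(1 + 4\<delta>) (1 - \<delta>)\<^sup>2 = 1 + \<delta> (2 - 7\<delta> + 4\<delta>\<^sup>2) \<ge> 1\<close> in the given range of \<open>\<delta>\<close>.\<close>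

text \<open>Cauchy--Schwarz for unordered sums. The finite inequality
  \<open>L2_set_mult_ineq\<close> bounds every finite partial sum of norms by the same constant,
  which yields both absolute summability of the products and the bound on the infinite sum.\<close>

lemma norm_infsum_mult_squared_le:
  fixes f g :: "'a \<Rightarrow> 'b::{banach, real_normed_div_algebra}"
  assumes f: "(\<lambda>x. (norm (f x))\<^sup>2) summable_on A"
    and g: "(\<lambda>x. (norm (g x))\<^sup>2) summable_on A"
  shows "(norm (\<Sum>\<^sub>\<infinity>x\<in>A. f x * g x))\<^sup>2
           \<le> (\<Sum>\<^sub>\<infinity>x\<in>A. (norm (f x))\<^sup>2) * (\<Sum>\<^sub>\<infinity>x\<in>A. (norm (g x))\<^sup>2)"
    (is "_ \<le> ?S * ?T")
proof -
  have partial: "(\<Sum>x\<in>F. norm (f x * g x)) \<le> sqrt (?S * ?T)" if F: "finite F" "F \<subseteq> A" for F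
  proof -
    have "(\<Sum>x\<in>F. norm (f x * g x)) \<le> L2_set (\<lambda>x. norm (f x)) F * L2_set (\<lambda>x. norm (g x)) F"
      using L2_set_mult_ineq[of "\<lambda>x. norm (f x)" "\<lambda>x. norm (g x)" F] by (simp add: norm_mult)
    also have "\<dots> \<le> sqrt ?S * sqrt ?T"
      unfolding L2_set_def using F
      by (intro mult_mono real_sqrt_le_mono finite_sum_le_infsum f g) (auto intro!: sum_nonneg infsum_nonneg)
    finally show ?thesis by (simp add: real_sqrt_mult)
  qed
  have summable: "(\<lambda>x. norm (f x * g x)) summable_on A"
    using partial by (intro nonneg_bdd_above_summable_on bdd_aboveI2) auto
  have "norm (\<Sum>\<^sub>\<infinity>x\<in>A. f x * g x) \<le> (\<Sum>\<^sub>\<infinity>x\<in>A. norm (f x * g x))"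
    by (rule norm_infsum_bound[OF summable])
  also have "\<dots> \<le> sqrt (?S * ?T)"
    by (rule infsum_le_finite_sums[OF summable partial])
  finally have "(norm (\<Sum>\<^sub>\<infinity>x\<in>A. f x * g x))\<^sup>2 \<le> (sqrt (?S * ?T))\<^sup>2"
    by (intro power_mono) auto
  also have "\<dots> = ?S * ?T"
    by (simp add: infsum_nonneg)
  finally show ?thesis .
qed

text \<open>The embedding of the reals preserves and reflects summability, so in the divergent case
  both sums take the default value 0.\<close>

lemma infsum_complex_of_real:
  "(\<Sum>\<^sub>\<infinity>x\<in>A. complex_of_real (f x)) = complex_of_real (\<Sum>\<^sub>\<infinity>x\<in>A. f x)"
proof (rule infsum_bounded_linear_strong[OF _ bounded_linear_of_real])
  show "(\<lambda>x. complex_of_real (f x)) summable_on A \<longleftrightarrow> f summable_on A"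
    using summable_on_Re[of "\<lambda>x. complex_of_real (f x)" A]
    by (auto intro: summable_on_of_real)
qed

text \<open>Because \<open>z * cnj z\<close> is the squared modulus of \<open>z\<close>, the
  diagonal value is a weighted mean of squares; this form gives its sign and matches the factors in
  Cauchy--Schwarz.\<close>

lemma Re_Psi2_diag:
  "Re (Psi2 G w L M M) = (\<Sum>\<^sub>\<infinity>\<pi>\<in>G. w \<pi> * (cmod (L \<pi> * M \<pi>))\<^sup>2) / (\<Sum>\<^sub>\<infinity>\<pi>\<in>G. w \<pi>)"
proof -
  have "(\<lambda>\<pi>. complex_of_real (w \<pi>) * (L \<pi> * M \<pi> * cnj (L \<pi> * M \<pi>))) =
        (\<lambda>\<pi>. complex_of_real (w \<pi> * (cmod (L \<pi> * M \<pi>))\<^sup>2))"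
    by (simp only: complex_norm_square of_real_mult)
  then have "Psi2 G w L M M = complex_of_real
      ((\<Sum>\<^sub>\<infinity>\<pi>\<in>G. w \<pi> * (cmod (L \<pi> * M \<pi>))\<^sup>2) / (\<Sum>\<^sub>\<infinity>\<pi>\<in>G. w \<pi>))"
    by (simp only: Psi2_def wexp_def infsum_complex_of_real of_real_divide)
  then show ?thesis by simp
qed

lemma Re_Psi2_diag_nonneg:
  assumes "\<And>\<pi>. \<pi> \<in> G \<Longrightarrow> w \<pi> \<ge> 0"
  shows "Re (Psi2 G w L M M) \<ge> 0"
  unfolding Re_Psi2_diag by (intro divide_nonneg_nonneg infsum_nonneg) (simp_all add: assms)

lemma cmod_Psi2_squared_le:
  assumes w: "\<And>\<pi>. \<pi> \<in> G \<Longrightarrow> w \<pi> \<ge> 0"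
    and M: "(\<lambda>\<pi>. w \<pi> * (cmod (L \<pi> * M \<pi>))\<^sup>2) summable_on G"
    and N: "(\<lambda>\<pi>. w \<pi> * (cmod (L \<pi> * N \<pi>))\<^sup>2) summable_on G"
  shows "(cmod (Psi2 G w L M N))\<^sup>2 \<le> Re (Psi2 G w L M M) * Re (Psi2 G w L N N)"
proof -
  \<comment> \<open>The weight is split evenly between the two factors, so that each squared norm
    carries exactly one \<open>w\<close>; conjugation in \<open>g\<close> does not affect its
    norm.\<close>
  define f where "f = (\<lambda>\<pi>. complex_of_real (sqrt (w \<pi>)) * (L \<pi> * M \<pi>))"
  define g where "g = (\<lambda>\<pi>. complex_of_real (sqrt (w \<pi>)) * cnj (L \<pi> * N \<pi>))"
  have f: "(cmod (f \<pi>))\<^sup>2 = w \<pi> * (cmod (L \<pi> * M \<pi>))\<^sup>2" if "\<pi> \<in> G" for \<pi>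
    using w[OF that] by (simp add: f_def norm_mult power_mult_distrib)
  have g: "(cmod (g \<pi>))\<^sup>2 = w \<pi> * (cmod (L \<pi> * N \<pi>))\<^sup>2" if "\<pi> \<in> G" for \<pi>
    using w[OF that] by (simp add: g_def norm_mult power_mult_distrib)
  have fg: "complex_of_real (w \<pi>) * (L \<pi> * M \<pi> * cnj (L \<pi> * N \<pi>)) = f \<pi> * g \<pi>"
    if "\<pi> \<in> G" for \<pi>
  proof -
    have "complex_of_real (w \<pi>) = complex_of_real (sqrt (w \<pi>)) * complex_of_real (sqrt (w \<pi>))"
      using w[OF that] by (simp flip: of_real_mult)
    then show ?thesis by (simp only: f_def g_def mult_ac)
  qed
  have "(cmod (\<Sum>\<^sub>\<infinity>\<pi>\<in>G. f \<pi> * g \<pi>))\<^sup>2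
          \<le> (\<Sum>\<^sub>\<infinity>\<pi>\<in>G. (cmod (f \<pi>))\<^sup>2) * (\<Sum>\<^sub>\<infinity>\<pi>\<in>G. (cmod (g \<pi>))\<^sup>2)"
    using M N by (intro norm_infsum_mult_squared_le) (simp_all add: f g cong: summable_on_cong)
  \<comment> \<open>The squared total weight supplies one denominator to each mean on the right, and
    is the square of the denominator of \<open>Psi2 G w L M N\<close> on the left.\<close>
  then have "(cmod (\<Sum>\<^sub>\<infinity>\<pi>\<in>G. f \<pi> * g \<pi>))\<^sup>2 / (\<Sum>\<^sub>\<infinity>\<pi>\<in>G. w \<pi>)\<^sup>2
      \<le> (\<Sum>\<^sub>\<infinity>\<pi>\<in>G. w \<pi> * (cmod (L \<pi> * M \<pi>))\<^sup>2) * (\<Sum>\<^sub>\<infinity>\<pi>\<in>G. w \<pi> * (cmod (L \<pi> * N \<pi>))\<^sup>2)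
          / (\<Sum>\<^sub>\<infinity>\<pi>\<in>G. w \<pi>)\<^sup>2"
    by (intro divide_right_mono) (simp_all only: f g zero_le_power2 cong: infsum_cong)
  then show ?thesis
    unfolding Re_Psi2_diag
    by (simp only: Psi2_def wexp_def fg norm_divide norm_of_real power_divide power2_abs
        times_divide_times_eq power2_eq_square[symmetric] cong: infsum_cong)
qed

theorem theorem2p4:
  fixes G :: "'a set" and w :: "'a \<Rightarrow> real" and L M N :: "'a \<Rightarrow> complex" and \<delta> :: real
  assumes w_nonneg: "\<And>\<pi>. \<pi> \<in> G \<Longrightarrow> w \<pi> \<ge> 0"
    and w_nonzero: "\<exists>\<pi>\<in>G. w \<pi> \<noteq> 0"
    and w_summable: "w summable_on G"
    and M_summable: "(\<lambda>\<pi>. w \<pi> * (cmod (L \<pi> * M \<pi>))\<^sup>2) summable_on G"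
    and N_summable: "(\<lambda>\<pi>. w \<pi> * (cmod (L \<pi> * N \<pi>))\<^sup>2) summable_on G"
    and \<delta>_range: "0 \<le> \<delta>" "\<delta> < 1 / 10"
    and Psi_MM: "Psi2 G w L M M \<noteq> 0"
    and ineq: "cmod (Psi G w L M * Psi2 G w L M N)
                 \<ge> (1 - \<delta>) * cmod (Psi G w L N) * Re (Psi2 G w L M M)"
  shows "beta G w L N \<le> (1 + 4 * \<delta>) * beta G w L M"
proof (cases "Psi2 G w L N N = 0")
  \<comment> \<open>Here \<open>beta G w L N\<close> is 0 by convention, so it suffices that the
    right-hand side is nonnegative.\<close>
  case True
  moreover have "Re (Psi2 G w L M M) \<ge> 0"
    by (intro Re_Psi2_diag_nonneg w_nonneg)
  ultimately show ?thesis
    using \<delta>_range by (simp add: beta_def)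
next
  case False
  define m n where "m = Re (Psi2 G w L M M)" and "n = Re (Psi2 G w L N N)"
  \<comment> \<open>A nonnegative real part that vanished would make the whole diagonal value 0,
    since that value is real. The instance \<open>\<lambda>x. x\<close> fills the index function
    left over from resolution with \<open>w_nonneg\<close>.\<close>
  have m: "m > 0"
    using Re_Psi2_diag_nonneg[OF w_nonneg, of G "\<lambda>x. x" L M] Psi_MM Psi2_diag_real[of G w L M]
    by (metis m_def less_eq_real_def of_real_0)
  have n: "n > 0"
    using Re_Psi2_diag_nonneg[OF w_nonneg, of G "\<lambda>x. x" L N] False Psi2_diag_real[of G w L N]
    by (metis n_def less_eq_real_def of_real_0)
  define a b where "a = (cmod (Psi G w L M))\<^sup>2" and "b = (cmod (Psi G w L N))\<^sup>2"
  have "((1 - \<delta>) * cmod (Psi G w L N) * m)\<^sup>2 \<le> (cmod (Psi G w L M * Psi2 G w L M N))\<^sup>2"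
    using ineq m \<delta>_range by (intro power_mono) (auto simp: m_def)
  also have "\<dots> \<le> a * (m * n)"
    using cmod_Psi2_squared_le[OF w_nonneg M_summable N_summable]
    by (simp add: norm_mult power_mult_distrib a_def m_def n_def mult_left_mono)
  \<comment> \<open>Squaring leaves \<open>m\<close> twice on the left, Cauchy--Schwarz leaves it
    once on the right; the terms are grouped so that one \<open>m\<close> cancels.\<close>
  finally have "m * ((1 - \<delta>)\<^sup>2 * b * m) \<le> m * (a * n)"
    by (simp add: power_mult_distrib b_def power2_eq_square mult_ac)
  then have "(1 - \<delta>)\<^sup>2 * b * m \<le> a * n"
    using m by simp
  \<comment> \<open>Both diagonal values being nonzero, \<open>b / n\<close> and
    \<open>a / m\<close> are the values of \<open>beta\<close> at \<open>N\<close> and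
    \<open>M\<close>.\<close>
  then have main: "(1 - \<delta>)\<^sup>2 * (b / n) \<le> a / m"
    using m n by (simp add: field_simps)
  \<comment> \<open>The bracket is positive, as \<open>\<delta> < 1 / 10\<close> gives
    \<open>7 * \<delta> < 2\<close>.\<close>
  have "0 \<le> \<delta> * (2 - 7 * \<delta> + 4 * \<delta>\<^sup>2)"
    using \<delta>_range by (intro mult_nonneg_nonneg add_nonneg_nonneg) auto
  also have "\<dots> = (1 + 4 * \<delta>) * (1 - \<delta>)\<^sup>2 - 1"
    by (simp add: power2_eq_square algebra_simps)
  finally have "1 \<le> (1 + 4 * \<delta>) * (1 - \<delta>)\<^sup>2"
    by simp
  then have "1 * (b / n) \<le> (1 + 4 * \<delta>) * (1 - \<delta>)\<^sup>2 * (b / n)"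
    using n by (intro mult_right_mono) (auto simp: b_def)
  also have "\<dots> \<le> (1 + 4 * \<delta>) * (a / m)"
    using main \<delta>_range unfolding mult.assoc by (intro mult_left_mono) auto
  finally show ?thesis
    using False Psi_MM by (simp add: beta_def a_def b_def m_def n_def)
qed

end
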